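(* Let $\gamma\geq 2$ be given, and consider the following system in $\mathbb{R}^n$: $$ \left\{\begin{array}{l} \partial_t \rho+ (v\cdot \nabla )\rho= -\rho \,\mathrm{div} \, v,\\ \partial_t v+(v\cdot \nabla) v =-\nabla p,\qquad p=e^S \rho^\gamma,\\ \partial_t S+ (v\cdot \nabla ) S =0,\\ v(x,0)=v_0 (x), \quad \rho(x,0)=\rho_0 (x),\quad S(x,0)=S_0(x). \end{array}\right. $$ Let $\mathcal{S}_3$ be the set of all points $a\in\mathbb{R}^n$ such that (i) $\Omega_0 (a)=0$; (ii) $D^k S_0 (a)=0$ for all $k\in\{1,2\}$, and $D^m \rho_0 (a)=0$ for all $m\in \{0,1,2\}$; (iii) there exists $j\in \{1,\dots, n\}$ such that $\lambda_j (a,0)<0$. Suppose the initial data $(v_0, \rho_0, S_0)$ satisfies $\mathcal{S}_3\neq\emptyset$. Then the $C^3$-regularity of the solution to the system with initial data $(v_0,\rho_0,S_0)$ cannot persist for an arbitrarily long time; that is, the solution cannot remain of class $C^3$ for all $t\ge 0$.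
   Context: The unknowns are the velocity field $v=(v^1,\dots,v^n)=v(x,t)$, the density $\rho=\rho(x,t)\ge 0$, and the entropy $S=S(x,t)$, for $x\in\mathbb{R}^n$, $t\ge 0$, with $n\geq 1$; $p$ is the pressure. The vorticity matrix of $v$ is $\Omega=(\Omega_{ij})$ with $\Omega_{ij}:=\partial_i v^j-\partial_j v^i$ (and $\Omega\equiv 0$ if $n=1$); $\Omega_0$ is the vorticity matrix of $v_0$. The deformation tensor is the symmetric matrix $\mathcal{D}=(\mathcal{D}_{ij})$ with $\mathcal{D}_{ij}=\frac12(\partial_i v^j+\partial_j v^i)$, and $\lambda_1(x,t),\dots,\lambda_n(x,t)$ denote its eigenvalues at $(x,t)$; in particular $\lambda_j(a,0)$ are the eigenvalues of the deformation tensor of $v_0$ at $a$. $D^m f$ denotes the collection of all partial derivatives of order $m$ of $f$ in $x$, with $D^0f=f$. *)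

theory Defs
  imports "HOL-Analysis.Analysis"
begin

definition partial_deriv :: "'n::finite \<Rightarrow> (real ^ 'n \<Rightarrow> real) \<Rightarrow> real ^ 'n \<Rightarrow> real" where
  "partial_deriv i f x = deriv (\<lambda>h. f (x + h *\<^sub>R axis i 1)) 0"

definition has_partial_deriv :: "'n::finite \<Rightarrow> (real ^ 'n \<Rightarrow> real) \<Rightarrow> real ^ 'n \<Rightarrow> bool" where
  "has_partial_deriv i f x \<longleftrightarrow> (\<lambda>h. f (x + h *\<^sub>R axis i 1)) field_differentiable (at 0)"

text \<open>The list collects the directions of differentiation, so the partial derivatives of order
  \<open>m\<close> are the \<open>iter_partial is f\<close> with \<open>length is = m\<close>.\<close>

definition iter_partial :: "'n::finite list \<Rightarrow> (real ^ 'n \<Rightarrow> real) \<Rightarrow> real ^ 'n \<Rightarrow> real" where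
  "iter_partial is f = foldr partial_deriv is f"

definition all_partials_vanish :: "nat \<Rightarrow> (real ^ 'n::finite \<Rightarrow> real) \<Rightarrow> real ^ 'n \<Rightarrow> bool" where
  "all_partials_vanish m f a \<longleftrightarrow> (\<forall>is. length is = m \<longrightarrow> iter_partial is f a = 0)"

definition gradient :: "(real ^ 'n::finite \<Rightarrow> real) \<Rightarrow> real ^ 'n \<Rightarrow> real ^ 'n" where
  "gradient f x = (\<chi> i. partial_deriv i f x)"

definition divergence :: "(real ^ 'n::finite \<Rightarrow> real ^ 'n) \<Rightarrow> real ^ 'n \<Rightarrow> real" where
  "divergence u x = (\<Sum>i\<in>UNIV. partial_deriv i (\<lambda>y. u y $ i) x)"

definition advect :: "(real ^ 'n::finite \<Rightarrow> real ^ 'n) \<Rightarrow> (real ^ 'n \<Rightarrow> real) \<Rightarrow> real ^ 'n \<Rightarrow> real" where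
  "advect u f x = (\<Sum>i\<in>UNIV. u x $ i * partial_deriv i f x)"

definition vorticity :: "(real ^ 'n::finite \<Rightarrow> real ^ 'n) \<Rightarrow> real ^ 'n \<Rightarrow> real ^ 'n ^ 'n" where
  "vorticity u x =
     (\<chi> i j. partial_deriv i (\<lambda>y. u y $ j) x - partial_deriv j (\<lambda>y. u y $ i) x)"

definition deformation :: "(real ^ 'n::finite \<Rightarrow> real ^ 'n) \<Rightarrow> real ^ 'n \<Rightarrow> real ^ 'n ^ 'n" where
  "deformation u x =
     (\<chi> i j. (partial_deriv i (\<lambda>y. u y $ j) x + partial_deriv j (\<lambda>y. u y $ i) x) / 2)"

definition is_eigenvalue :: "real ^ 'n ^ 'n::finite \<Rightarrow> real \<Rightarrow> bool" where
  "is_eigenvalue A l \<longleftrightarrow> (\<exists>w. w \<noteq> 0 \<and> A *v w = l *s w)"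

text \<open>Membership of a function of \<open>(x, t)\<close> in \<open>C([0,\<infinity>); C\<^sup>k(\<real>\<^sup>n))\<close>, the latter space carrying
  locally uniform convergence of the derivatives: all partial derivatives in \<open>x\<close> up to order \<open>k\<close>
  exist and are jointly continuous on \<open>\<real>\<^sup>n \<times> [0,\<infinity>)\<close>. Every function of class \<open>C\<^sup>k\<close> in
  \<open>(x, t)\<close> jointly satisfies this.\<close>

definition C_class :: "nat \<Rightarrow> (real ^ 'n::finite \<Rightarrow> real \<Rightarrow> real) \<Rightarrow> bool" where
  "C_class k f \<longleftrightarrow>
     (\<forall>is. length is \<le> k \<longrightarrow>
        continuous_on (UNIV \<times> {0..}) (\<lambda>(x, t). iter_partial is (\<lambda>y. f y t) x)) \<and>
     (\<forall>is i x. \<forall>t\<ge>0. length is < k \<longrightarrow> has_partial_deriv i (iter_partial is (\<lambda>y. f y t)) x)"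

definition pressure ::
  "real \<Rightarrow> (real ^ 'n::finite \<Rightarrow> real) \<Rightarrow> (real ^ 'n \<Rightarrow> real) \<Rightarrow> real ^ 'n \<Rightarrow> real" where
  "pressure \<gamma> S \<rho> x = exp (S x) * \<rho> x powr \<gamma>"

text \<open>At \<open>t = 0\<close> the time derivatives below are one-sided.\<close>

definition euler_solution ::
  "real \<Rightarrow> (real ^ 'n::finite \<Rightarrow> real ^ 'n) \<Rightarrow> (real ^ 'n \<Rightarrow> real) \<Rightarrow> (real ^ 'n \<Rightarrow> real) \<Rightarrow>
   (real ^ 'n \<Rightarrow> real \<Rightarrow> real ^ 'n) \<Rightarrow> (real ^ 'n \<Rightarrow> real \<Rightarrow> real) \<Rightarrow> (real ^ 'n \<Rightarrow> real \<Rightarrow> real) \<Rightarrow> bool"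
  where
  "euler_solution \<gamma> v0 \<rho>0 S0 v \<rho> S \<longleftrightarrow>
     (\<forall>x. \<forall>t\<ge>0. \<rho> x t \<ge> 0) \<and>
     (\<forall>x. \<forall>t\<ge>0. \<exists>d. ((\<lambda>s. \<rho> x s) has_real_derivative d) (at t within {0..}) \<and>
        d + advect (\<lambda>y. v y t) (\<lambda>y. \<rho> y t) x = - \<rho> x t * divergence (\<lambda>y. v y t) x) \<and>
     (\<forall>x. \<forall>t\<ge>0. \<exists>d. ((\<lambda>s. v x s) has_vector_derivative d) (at t within {0..}) \<and>
        d + (\<chi> j. advect (\<lambda>y. v y t) (\<lambda>y. v y t $ j) x) =
        - gradient (pressure \<gamma> (\<lambda>y. S y t) (\<lambda>y. \<rho> y t)) x) \<and>
     (\<forall>x. \<forall>t\<ge>0. \<exists>d. ((\<lambda>s. S x s) has_real_derivative d) (at t within {0..}) \<and>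
        d + advect (\<lambda>y. v y t) (\<lambda>y. S y t) x = 0) \<and>
     (\<forall>x. v x 0 = v0 x \<and> \<rho> x 0 = \<rho>0 x \<and> S x 0 = S0 x)"

definition S3_set ::
  "(real ^ 'n::finite \<Rightarrow> real ^ 'n) \<Rightarrow> (real ^ 'n \<Rightarrow> real) \<Rightarrow> (real ^ 'n \<Rightarrow> real) \<Rightarrow> (real ^ 'n) set"
  where
  "S3_set v0 \<rho>0 S0 = {a.
     vorticity v0 a = 0 \<and>
     (\<forall>k\<in>{1, 2}. all_partials_vanish k S0 a) \<and>
     (\<forall>m\<in>{0, 1, 2}. all_partials_vanish m \<rho>0 a) \<and>
     (\<exists>l. is_eigenvalue (deformation v0 a) l \<and> l < 0)}"

end

theory Submission
  imports Defs
begin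

text \<open>
  A point \<open>a\<close> of vacuum with irrotational data is followed along the straight line
  \<open>X t = a + t v0(a)\<close>. Near a vacuum the pressure \<open>e\<^sup>S \<rho>\<^sup>\<gamma>\<close> with \<open>\<gamma> \<ge> 2\<close> is so flat that its gradient is a
  bounded multiple of \<open>\<rho>\<close>. Hence the pair \<open>(v - v0(a), \<rho>)\<close>, evaluated on this line, solves a
  homogeneous linear system of ordinary differential equations with zero initial values, and it
  vanishes (\<open>vacuum_along_line\<close>): the fluid particle stays in the vacuum and never accelerates.
  Working on the line from the start, instead of on the trajectory of \<open>a\<close>, dispenses with any
  existence theory for trajectories, which could a priori escape to infinity in finite time.

  As \<open>\<rho> \<ge> 0\<close>, the gradient of \<open>\<rho>\<close> vanishes on the line as well, and with it the Hessian of the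
  pressure. Differentiating the momentum equation in space therefore leaves the Riccati equation
  \<open>V' = - V V\<close> for the velocity gradient \<open>V\<close> on the line (\<open>gradient_riccati\<close>). Initially \<open>V\<close> is
  the deformation matrix, because the vorticity vanishes at \<open>a\<close>. If \<open>V(0) w = l w\<close>, then
  \<open>z(t) = (1 + t l) V(t) w - l w\<close> satisfies \<open>z' = - V z\<close> and \<open>z(0) = 0\<close>, so it vanishes for all
  times. For \<open>l < 0\<close> the time \<open>t = - 1 / l\<close> yields \<open>l w = 0\<close>, a contradiction
  (\<open>eigenvalue_nonneg\<close>).
\<close>

section \<open>Uniqueness for homogeneous linear systems\<close>

text \<open>Gronwall's argument: the squared norm \<open>E\<close> of the solution satisfies \<open>E' \<le> 2 K E\<close> when \<open>K\<close> bounds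
  the coefficients on \<open>[0, T]\<close>, so \<open>E(t) exp (- 2 K t)\<close> cannot grow from its initial value \<open>0\<close>.\<close>

lemma linear_ode_zero:
  fixes y :: "'i::finite \<Rightarrow> real \<Rightarrow> real"
  assumes deriv: "\<And>i t. 0 \<le> t \<Longrightarrow>
      (y i has_real_derivative (\<Sum>j\<in>UNIV. A i j t * y j t)) (at t within {0..})"
    and cont: "\<And>i j. continuous_on {0..} (A i j)"
    and init: "\<And>i. y i 0 = 0"
    and "0 \<le> T"
  shows "y i T = 0"
proof -
  define N where "N t = (\<Sum>i\<in>UNIV. \<Sum>j\<in>UNIV. \<bar>A i j t\<bar>)" for t
  define E where "E t = (\<Sum>i\<in>UNIV. (y i t)\<^sup>2)" for t
  define E' where "E' t = (\<Sum>i\<in>UNIV. 2 * y i t * (\<Sum>j\<in>UNIV. A i j t * y j t))" for t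
  have "continuous_on {0..T} N"
    unfolding N_def by (intro continuous_intros continuous_on_subset[OF cont]) auto
  then have "bounded (N ` {0..T})"
    by (intro compact_imp_bounded compact_continuous_image) auto
  then obtain K where K: "\<And>t. t \<in> {0..T} \<Longrightarrow> N t \<le> K"
    unfolding bounded_iff by (metis abs_le_D1 imageI real_norm_def)
  have E_deriv: "(E has_real_derivative E' t) (at t within {0..})" if "0 \<le> t" for t
    unfolding E_def E'_def
    by (rule DERIV_sum) (auto intro!: derivative_eq_intros deriv that)
  have E_bound: "E' t \<le> 2 * K * E t" if "t \<in> {0..T}" for t
  proof -
    have E_nonneg: "0 \<le> E t"
      unfolding E_def by (intro sum_nonneg) auto
    have le: "(y i t)\<^sup>2 \<le> E t" for i
      unfolding E_def by (rule member_le_sum) auto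
    have prod: "2 * y i t * (A i j t * y j t) \<le> \<bar>A i j t\<bar> * (2 * E t)" for i j
    proof -
      have "2 * \<bar>y i t\<bar> * \<bar>y j t\<bar> \<le> (y i t)\<^sup>2 + (y j t)\<^sup>2"
        using sum_squares_bound[of "\<bar>y i t\<bar>" "\<bar>y j t\<bar>"] by simp
      also have "\<dots> \<le> 2 * E t"
        using le[of i] le[of j] by simp
      finally have *: "2 * \<bar>y i t\<bar> * \<bar>y j t\<bar> \<le> 2 * E t" .
      have "2 * y i t * (A i j t * y j t) \<le> \<bar>2 * y i t * (A i j t * y j t)\<bar>"
        by (rule abs_ge_self)
      also have "\<dots> = \<bar>A i j t\<bar> * (2 * \<bar>y i t\<bar> * \<bar>y j t\<bar>)"
        by (simp add: abs_mult)
      also have "\<dots> \<le> \<bar>A i j t\<bar> * (2 * E t)"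
        by (rule mult_left_mono[OF *]) simp
      finally show ?thesis .
    qed
    have "E' t = (\<Sum>i\<in>UNIV. \<Sum>j\<in>UNIV. 2 * y i t * (A i j t * y j t))"
      unfolding E'_def by (simp add: sum_distrib_left)
    also have "\<dots> \<le> (\<Sum>i\<in>UNIV. \<Sum>j\<in>UNIV. \<bar>A i j t\<bar> * (2 * E t))"
      by (intro sum_mono prod)
    also have "\<dots> = N t * (2 * E t)"
      unfolding N_def by (simp add: sum_distrib_right)
    also have "\<dots> \<le> K * (2 * E t)"
      using K[OF that] E_nonneg by (intro mult_right_mono) auto
    finally show ?thesis by simp
  qed
  let ?\<phi> = "\<lambda>t. E t * exp (- (2 * K * t))"
  have \<phi>_deriv: "(?\<phi> has_real_derivative (E' t - 2 * K * E t) * exp (- (2 * K * t)))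
      (at t within {0..})" if "0 \<le> t" for t
    by (rule derivative_eq_intros E_deriv that refl | simp add: algebra_simps that)+
  have "?\<phi> 0 \<ge> ?\<phi> T"
  proof (rule DERIV_nonpos_imp_decreasing_open[OF \<open>0 \<le> T\<close>])
    fix t assume t: "0 < t" "t < T"
    have "(?\<phi> has_real_derivative (E' t - 2 * K * E t) * exp (- (2 * K * t))) (at t)"
      using \<phi>_deriv[of t] t by (simp add: at_within_interior[of t "{0..}"])
    moreover have "(E' t - 2 * K * E t) * exp (- (2 * K * t)) \<le> 0"
      using E_bound[of t] t by (intro mult_nonpos_nonneg) auto
    ultimately show "\<exists>d. (?\<phi> has_real_derivative d) (at t) \<and> d \<le> 0"
      by blast
  next
    have "continuous_on {0..} ?\<phi>"
      by (rule DERIV_continuous_on) (use \<phi>_deriv in auto)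
    then show "continuous_on {0..T} ?\<phi>"
      by (rule continuous_on_subset) auto
  qed
  then have "E T \<le> 0"
    by (simp add: E_def init mult_le_0_iff) 
  then have "E T = 0"
    unfolding E_def by (simp add: antisym sum_nonneg)
  then show ?thesis
    unfolding E_def by (simp add: sum_nonneg_eq_0_iff)
qed

section \<open>Interchanging two derivatives\<close>

text \<open>Up to \<open>u h b\<close>, the function \<open>u h s\<close> is the integral of \<open>F h\<close> over \<open>{b..s}\<close>. Differentiation under the
  integral sign gives \<open>W s - W b\<close> as the integral of \<open>G 0\<close>. The half-line \<open>{b..}\<close> lets the same lemma
  serve for the one-sided time derivative and, with \<open>0\<close> in its interior, for two space variables.\<close>

lemma interchange_derivatives:
  fixes u F G :: "real \<Rightarrow> real \<Rightarrow> real" and W :: "real \<Rightarrow> real"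
  assumes u: "\<And>h s. b \<le> s \<Longrightarrow> (u h has_real_derivative F h s) (at s within {b..})"
    and F: "\<And>h s. b \<le> s \<Longrightarrow> ((\<lambda>h. F h s) has_real_derivative G h s) (at h)"
    and G: "continuous_on (UNIV \<times> {b..}) (\<lambda>(h, s). G h s)"
    and W: "\<And>s. b \<le> s \<Longrightarrow> ((\<lambda>h. u h s) has_real_derivative W s) (at 0)"
    and "b \<le> t"
  shows "(W has_real_derivative G 0 t) (at t within {b..})"
proof -
  have ftc: "(F h has_integral u h s - u h b) {b..s}" if "b \<le> s" for h s
    by (rule fundamental_theorem_of_calculus[OF that])
      (auto simp flip: has_real_derivative_iff_has_vector_derivative
        intro: has_field_derivative_subset[OF u])
  have G0: "continuous_on {b..} (G 0)"
    by (rule continuous_on_compose2[OF G, of _ "\<lambda>s. (0, s)", simplified])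
      (auto intro!: continuous_intros)
  have W_eq: "W s = W b + integral {b..s} (G 0)" if s: "b \<le> s" for s
  proof -
    have "((\<lambda>h. integral (cbox b s) (F h)) has_field_derivative integral (cbox b s) (G 0))
        (at 0 within UNIV)"
      by (rule leibniz_rule_field_derivative)
        (use F s ftc[OF s] in \<open>auto intro: has_integral_integrable continuous_on_subset[OF G]\<close>)
    moreover have "integral (cbox b s) (F h) = u h s - u h b" for h
      using ftc[OF s, of h] by (simp add: integral_unique)
    ultimately have "((\<lambda>h. u h s - u h b) has_real_derivative integral {b..s} (G 0)) (at 0)"
      by simp
    moreover have "((\<lambda>h. u h s - u h b) has_real_derivative W s - W b) (at 0)"
      by (intro DERIV_diff W s) simp
    ultimately show ?thesis
      using DERIV_unique by fastforce
  qed
  \<comment> \<open>Any endpoint to the right of \<open>t\<close> would do in place of \<open>t + 1\<close>.\<close>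
  have "((\<lambda>s. W b + integral {b..s} (G 0)) has_real_derivative G 0 t) (at t within {b..t + 1})"
    using integral_has_real_derivative[OF continuous_on_subset[OF G0], of b "t + 1" t] \<open>b \<le> t\<close>
    by (auto intro!: derivative_eq_intros)
  then have "(W has_real_derivative G 0 t) (at t within {b..t + 1})"
    by (rule has_field_derivative_transform_within[OF _ zero_less_one])
      (use \<open>b \<le> t\<close> in \<open>auto simp: W_eq[symmetric]\<close>)
  moreover have "at t within {b..t + 1} = at t within {b..}"
    by (rule at_within_nhd[of t "{..<t + 1}"]) auto
  ultimately show ?thesis by simp
qed

section \<open>Powers with a real exponent near zero\<close>

text \<open>Since \<open>0 powr 0 = 0\<close>, the function \<open>\<bar>r\<bar> powr b\<close> is discontinuous for \<open>b = 0\<close>. The value \<open>1\<close> there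
  makes the borderline exponent \<open>\<gamma> = 2\<close> an instance of the general case, and the absolute value
  gives derivatives that are two-sided at the vacuum value \<open>r = 0\<close>.\<close>

definition abs_power :: "real \<Rightarrow> real \<Rightarrow> real" where
  "abs_power b r = (if b = 0 then 1 else \<bar>r\<bar> powr b)"

lemma continuous_on_abs_power:
  assumes "0 \<le> b" and "continuous_on A f"
  shows "continuous_on A (\<lambda>x. abs_power b (f x))"
proof (cases "b = 0")
  case False
  with assms(1) have "0 < b" by simp
  then show ?thesis
    unfolding abs_power_def using assms(2)
    by (simp, intro continuous_on_powr' continuous_intros) auto
qed (simp add: abs_power_def)

lemma DERIV_mult_abs_power:
  assumes "0 \<le> b"
  shows "((\<lambda>r. r * abs_power b r) has_real_derivative (b + 1) * abs_power b r) (at r)"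
proof (cases "b = 0")
  case True
  then show ?thesis by (auto simp: abs_power_def)
next
  case False
  then have b: "b > 0" using assms by simp
  \<comment> \<open>In this form no sign of \<open>x\<close> has to be distinguished.\<close>
  have even: "abs_power b x = (x\<^sup>2) powr (b / 2)" for x
    using b powr_powr[of "\<bar>x\<bar>" 2 "b / 2"] by (auto simp: abs_power_def)
  show ?thesis
  proof (cases "r = 0")
    case True
    have "isCont (abs_power b) 0"
      using continuous_on_abs_power[OF assms, of UNIV "\<lambda>x. x"]
      by (simp add: continuous_on_eq_continuous_at)
    then have "(abs_power b \<longlongrightarrow> 0) (at 0)"
      using b by (simp add: isCont_def abs_power_def)
    then have "((\<lambda>h. h * abs_power b h / h) \<longlongrightarrow> 0) (at 0)"
      by (rule Lim_transform_eventually) (auto simp: eventually_at_filter)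
    then show ?thesis
      using True b by (simp add: DERIV_def abs_power_def)
  next
    case False
    have pos: "0 < r * r"
      using False by (auto simp: zero_less_mult_iff)
    have "(r\<^sup>2) powr (b / 2 - 1) * r\<^sup>2 = (r\<^sup>2) powr (b / 2)"
      using False by (simp add: powr_diff)
    then have "((\<lambda>x. x * (x\<^sup>2) powr (b / 2)) has_real_derivative
        (b + 1) * (r\<^sup>2) powr (b / 2)) (at r)"
      using pos
      by (auto intro!: derivative_eq_intros simp: algebra_simps power2_eq_square)
    then show ?thesis
      by (simp add: even)
  qed
qed



section \<open>Calculus in the classes of continuously differentiable fields\<close>

abbreviation pd :: "'n::finite \<Rightarrow> (real ^ 'n \<Rightarrow> real \<Rightarrow> real) \<Rightarrow> real ^ 'n \<Rightarrow> real \<Rightarrow> real" where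
  "pd i f x t \<equiv> partial_deriv i (\<lambda>y. f y t) x"

lemma partial_deriv_DERIV:
  assumes "has_partial_deriv i f x"
  shows "((\<lambda>h. f (x + h *\<^sub>R axis i 1)) has_real_derivative partial_deriv i f x) (at 0)"
  using assms unfolding has_partial_deriv_def partial_deriv_def
  by (simp add: DERIV_deriv_iff_field_differentiable)

lemma partial_deriv_eqI:
  assumes "((\<lambda>h. f (x + h *\<^sub>R axis i 1)) has_real_derivative d) (at 0)"
  shows "partial_deriv i f x = d" and "has_partial_deriv i f x"
  using assms unfolding has_partial_deriv_def partial_deriv_def
  by (auto simp: DERIV_imp_deriv field_differentiable_def)

lemma partial_deriv_DERIV_line:
  assumes "\<And>x. has_partial_deriv i f x"
  shows "((\<lambda>h. f (x + h *\<^sub>R axis i 1)) has_real_derivative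
           partial_deriv i f (x + h *\<^sub>R axis i 1)) (at h)"
proof -
  have "((\<lambda>k. f ((x + h *\<^sub>R axis i 1) + k *\<^sub>R axis i 1)) has_real_derivative
      partial_deriv i f (x + h *\<^sub>R axis i 1)) (at 0)"
    by (intro partial_deriv_DERIV assms)
  then show ?thesis
    using DERIV_shift[of "\<lambda>k. f (x + k *\<^sub>R axis i 1)" _ 0 h]
    by (simp add: scaleR_add_left add_ac)
qed

lemma C_class_0:
  "C_class 0 f \<longleftrightarrow> continuous_on (UNIV \<times> {0..}) (\<lambda>(x, t). f x t)"
  by (simp add: C_class_def iter_partial_def)

lemma iter_partial_snoc:
  "iter_partial (is @ [i]) f = iter_partial is (partial_deriv i f)"
  by (simp add: iter_partial_def)

text \<open>The iterated partial derivatives in the definition apply the last direction of the list first, so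
  the last entry can be split off. This recursion on the order carries all closure properties below.\<close>

lemma C_class_Suc:
  "C_class (Suc k) f \<longleftrightarrow> C_class 0 f \<and>
     (\<forall>i x. \<forall>t\<ge>0. has_partial_deriv i (\<lambda>y. f y t) x) \<and> (\<forall>i. C_class k (pd i f))"
  (is "?L \<longleftrightarrow> ?R")
proof
  assume L: ?L
  have "C_class k (pd i f)" for i
    unfolding C_class_def
  proof (intro conjI allI impI)
    fix js :: "'a list"
    assume "length js \<le> k"
    then have "continuous_on (UNIV \<times> {0..}) (\<lambda>(x, t). iter_partial (js @ [i]) (\<lambda>y. f y t) x)"
      using L unfolding C_class_def by (metis Suc_le_mono length_append_singleton)
    then show "continuous_on (UNIV \<times> {0..}) (\<lambda>(x, t). iter_partial js (\<lambda>y. pd i f y t) x)"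
      by (simp add: iter_partial_snoc)
  next
    fix js :: "'a list" and j x and t :: real
    assume "length js < k" "0 \<le> t"
    then have "has_partial_deriv j (iter_partial (js @ [i]) (\<lambda>y. f y t)) x"
      using L unfolding C_class_def by (metis Suc_mono length_append_singleton)
    then show "has_partial_deriv j (iter_partial js (\<lambda>y. pd i f y t)) x"
      by (simp add: iter_partial_snoc)
  qed
  moreover have "has_partial_deriv i (\<lambda>y. f y t) x" if "t \<ge> 0" for i x t
    using L that unfolding C_class_def
    by (auto dest!: spec[of _ "[]"] simp: iter_partial_def)
  moreover have "C_class 0 f"
    using L by (auto simp: C_class_def)
  ultimately show ?R by blast
next
  assume R: ?R
  show ?L
    unfolding C_class_def
  proof (intro conjI allI impI)
    fix "is" :: "'a list"
    assume "length is \<le> Suc k"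
    then show "continuous_on (UNIV \<times> {0..}) (\<lambda>(x, t). iter_partial is (\<lambda>y. f y t) x)"
    proof (cases "is" rule: rev_cases)
      case Nil
      then show ?thesis using R by (simp add: C_class_0 iter_partial_def)
    next
      case (snoc js i)
      then show ?thesis
        using R \<open>length is \<le> Suc k\<close> by (simp add: C_class_def iter_partial_snoc)
    qed
  next
    fix "is" :: "'a list" and j x and t :: real
    assume "length is < Suc k" "0 \<le> t"
    then show "has_partial_deriv j (iter_partial is (\<lambda>y. f y t)) x"
    proof (cases "is" rule: rev_cases)
      case Nil
      then show ?thesis using R \<open>0 \<le> t\<close> by (simp add: iter_partial_def)
    next
      case (snoc js i)
      then show ?thesis
        using R \<open>length is < Suc k\<close> \<open>0 \<le> t\<close> by (simp add: C_class_def iter_partial_snoc)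
    qed
  qed
qed

lemma C_class_SucI:
  fixes f :: "real ^ 'n::finite \<Rightarrow> real \<Rightarrow> real"
  assumes "C_class 0 f"
    and "\<And>i x t. 0 \<le> t \<Longrightarrow> ((\<lambda>h. f (x + h *\<^sub>R axis i 1) t) has_real_derivative f' i x t) (at 0)"
    and "\<And>i. C_class k (f' i)"
  shows "C_class (Suc k) f"
proof -
  have eq: "pd i f x t = f' i x t" if "0 \<le> t" for i x t
    by (rule partial_deriv_eqI(1)) (rule assms(2)[OF that])
  then have eq_fun: "(\<lambda>y. pd i f y t) = (\<lambda>y. f' i y t)" if "0 \<le> t" for i t
    using that by auto
  have "C_class k (pd i f) \<longleftrightarrow> C_class k (f' i)" for i
    unfolding C_class_def
    by (intro arg_cong2[of _ _ _ _ "(\<and>)"] all_cong1 imp_cong refl continuous_on_cong)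
      (auto simp: eq_fun)
  moreover have "has_partial_deriv i (\<lambda>y. f y t) x" if "0 \<le> t" for i x t
    by (rule partial_deriv_eqI(2)) (rule assms(2)[OF that])
  ultimately show ?thesis
    using assms by (simp add: C_class_Suc)
qed

lemma C_class_DERIV:
  assumes "C_class (Suc k) f" and "0 \<le> t"
  shows "((\<lambda>h. f (x + h *\<^sub>R axis i 1) t) has_real_derivative pd i f x t) (at 0)"
    and "((\<lambda>h. f (x + h *\<^sub>R axis i 1) t) has_real_derivative pd i f (x + h *\<^sub>R axis i 1) t) (at h)"
  using assms partial_deriv_DERIV[of i "\<lambda>y. f y t" x]
    partial_deriv_DERIV_line[of i "\<lambda>y. f y t" x h]
  by (simp_all add: C_class_Suc)

lemma C_class_pd: "C_class (Suc k) f \<Longrightarrow> C_class k (pd i f)"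
  by (simp add: C_class_Suc)

lemma C_class_mono: "C_class m f \<Longrightarrow> k \<le> m \<Longrightarrow> C_class k f"
  unfolding C_class_def by auto

lemma C_class_const: "C_class k (\<lambda>x t. c)"
proof (induction k arbitrary: c)
  case 0
  then show ?case by (simp add: C_class_0)
next
  case (Suc k)
  show ?case
    by (rule C_class_SucI[where f' = "\<lambda>i x t. 0"]) (auto simp: C_class_0 Suc)
qed

lemma C_class_add:
  assumes "C_class k f" and "C_class k g"
  shows "C_class k (\<lambda>x t. f x t + g x t)"
  using assms
proof (induction k arbitrary: f g)
  case 0
  then show ?case by (auto simp: C_class_0 case_prod_unfold intro!: continuous_intros)
next
  case (Suc k)
  show ?case
  proof (rule C_class_SucI)
    show "C_class 0 (\<lambda>x t. f x t + g x t)"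
      using Suc.prems[THEN C_class_mono, of 0]
      by (auto simp: C_class_0 case_prod_unfold intro!: continuous_intros)
    show "((\<lambda>h. f (x + h *\<^sub>R axis i 1) t + g (x + h *\<^sub>R axis i 1) t) has_real_derivative
        pd i f x t + pd i g x t) (at 0)" if "0 \<le> t" for i x t
      by (intro DERIV_add Suc.prems[THEN C_class_DERIV(1), OF that])
    show "C_class k (\<lambda>x t. pd i f x t + pd i g x t)" for i
      by (intro Suc.IH C_class_pd Suc.prems)
  qed
qed

lemma C_class_mult:
  assumes "C_class k f" and "C_class k g"
  shows "C_class k (\<lambda>x t. f x t * g x t)"
  using assms
proof (induction k arbitrary: f g)
  case 0
  then show ?case by (auto simp: C_class_0 case_prod_unfold intro!: continuous_intros)
next
  case (Suc k)
  show ?case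
  proof (rule C_class_SucI)
    show "C_class 0 (\<lambda>x t. f x t * g x t)"
      using Suc.prems[THEN C_class_mono, of 0]
      by (auto simp: C_class_0 case_prod_unfold intro!: continuous_intros)
    show "((\<lambda>h. f (x + h *\<^sub>R axis i 1) t * g (x + h *\<^sub>R axis i 1) t) has_real_derivative
        pd i f x t * g x t + pd i g x t * f x t) (at 0)" if "0 \<le> t" for i x t
      using DERIV_mult[OF C_class_DERIV(1)[OF Suc.prems(1) that] C_class_DERIV(1)[OF Suc.prems(2) that]]
      by simp
    show "C_class k (\<lambda>x t. pd i f x t * g x t + pd i g x t * f x t)" for i
      using Suc.prems by (intro C_class_add Suc.IH C_class_pd C_class_mono[of "Suc k" _ k]) simp_all
  qed
qed

lemma C_class_sum:
  assumes "\<And>i. i \<in> I \<Longrightarrow> C_class k (f i)"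
  shows "C_class k (\<lambda>x t. \<Sum>i\<in>I. f i x t)"
  using assms
  by (induction I rule: infinite_finite_induct) (auto intro: C_class_const C_class_add)

lemma C_class_minus: "C_class k f \<Longrightarrow> C_class k (\<lambda>x t. - f x t)"
  using C_class_mult[OF C_class_const[of k "-1"], of f] by simp

lemma C_class_compose:
  assumes f: "C_class (Suc k) f"
    and \<phi>: "\<And>r. (\<phi> has_real_derivative \<phi>' r) (at r)"
    and \<phi>': "C_class k (\<lambda>x t. \<phi>' (f x t))"
  shows "C_class (Suc k) (\<lambda>x t. \<phi> (f x t))"
    and "0 \<le> t \<Longrightarrow> pd i (\<lambda>x t. \<phi> (f x t)) x t = \<phi>' (f x t) * pd i f x t"
proof -
  have deriv: "((\<lambda>h. \<phi> (f (x + h *\<^sub>R axis i 1) t)) has_real_derivative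
      \<phi>' (f x t) * pd i f x t) (at 0)" if "0 \<le> t" for i x t
    using DERIV_chain2[OF \<phi> C_class_DERIV(1)[OF f that], of x i] by simp
  show "C_class (Suc k) (\<lambda>x t. \<phi> (f x t))"
  proof (rule C_class_SucI[OF _ deriv])
    have "continuous_on UNIV \<phi>"
      using \<phi> by (meson DERIV_continuous_on DERIV_subset UNIV_I subset_UNIV)
    moreover have "C_class 0 f" using f by (rule C_class_mono) simp
    ultimately show "C_class 0 (\<lambda>x t. \<phi> (f x t))"
      by (auto simp: C_class_0 case_prod_unfold intro: continuous_on_compose2)
    show "C_class k (\<lambda>x t. \<phi>' (f x t) * pd i f x t)" for i
      by (intro C_class_mult \<phi>' C_class_pd f)
  qed
  show "0 \<le> t \<Longrightarrow> pd i (\<lambda>x t. \<phi> (f x t)) x t = \<phi>' (f x t) * pd i f x t"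
    by (intro partial_deriv_eqI(1) deriv)
qed

text \<open>The form of continuity needed on lines in space-time and on coordinate planes.\<close>

lemma continuous_on_C_class:
  assumes "C_class k f" and "continuous_on A p" and "continuous_on A \<tau>"
    and "\<And>z. z \<in> A \<Longrightarrow> 0 \<le> \<tau> z"
  shows "continuous_on A (\<lambda>z. f (p z) (\<tau> z))"
proof -
  have "continuous_on (UNIV \<times> {0..}) (\<lambda>(x, t). f x t)"
    using C_class_mono[OF assms(1), of 0] by (simp add: C_class_0)
  moreover have "continuous_on A (\<lambda>z. (p z, \<tau> z))"
    by (intro continuous_intros assms)
  ultimately show ?thesis
    using continuous_on_compose2[of "UNIV \<times> {0..}" "\<lambda>(x, t). f x t" A "\<lambda>z. (p z, \<tau> z)"]
      assms(4) by auto
qed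

section \<open>Derivatives along a moving point\<close>

lemma mean_value_step:
  fixes \<phi> \<phi>' :: "real \<Rightarrow> real"
  assumes "\<And>h. (\<phi> has_real_derivative \<phi>' h) (at h)"
  shows "\<exists>z. \<bar>z\<bar> \<le> \<bar>h\<bar> \<and> \<phi> h - \<phi> 0 = h * \<phi>' z"
proof -
  consider "h = 0" | "0 < h" | "h < 0" by linarith
  then show ?thesis
  proof cases
    case 2
    then obtain z where "0 < z" "z < h" "\<phi> h - \<phi> 0 = (h - 0) * \<phi>' z"
      using MVT2[of 0 h \<phi> \<phi>'] assms by blast
    then show ?thesis by (intro exI[of _ z]) auto
  next
    case 3
    then obtain z where "h < z" "z < 0" "\<phi> 0 - \<phi> h = (0 - h) * \<phi>' z"
      using MVT2[of h 0 \<phi> \<phi>'] assms by blast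
    then show ?thesis by (intro exI[of _ z]) auto
  qed auto
qed

text \<open>The coordinate displacements are added one at a time. Each of them contributes, by the mean value
  theorem, a partial derivative at a point close to the line, and joint continuity of the partial
  derivatives gives the limit.\<close>

lemma DERIV_along_line:
  fixes f F :: "real ^ 'n::finite \<Rightarrow> real \<Rightarrow> real"
  assumes f: "C_class 1 f"
    and F: "\<And>x t. 0 \<le> t \<Longrightarrow> (f x has_real_derivative F x t) (at t within {0..})"
    and t: "0 \<le> t"
  shows "((\<lambda>s. f (a + s *\<^sub>R c) s) has_real_derivative
    F (a + t *\<^sub>R c) t + (\<Sum>i\<in>UNIV. c $ i * pd i f (a + t *\<^sub>R c) t)) (at t within {0..})"
proof -
  have partial: "((\<lambda>s. f (x + (s - t) *\<^sub>R (\<Sum>i\<in>I. c $ i *\<^sub>R axis i 1)) s) has_real_derivative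
      F x t + (\<Sum>i\<in>I. c $ i * pd i f x t)) (at t within {0..})" if "finite I" for I x
    using that
  proof induction
    case empty
    then show ?case using F[OF t] by simp
  next
    case (insert i I)
    define w where "w = (\<Sum>i\<in>I. c $ i *\<^sub>R axis i (1::real))"
    define \<delta> where "\<delta> s = f (x + (s - t) *\<^sub>R w + ((s - t) * c $ i) *\<^sub>R axis i 1) s -
      f (x + (s - t) *\<^sub>R w) s" for s
    have "\<exists>z. \<bar>z\<bar> \<le> \<bar>(s - t) * c $ i\<bar> \<and>
        \<delta> s = (s - t) * c $ i * pd i f (x + (s - t) *\<^sub>R w + z *\<^sub>R axis i 1) s" if "0 \<le> s" for s
      using mean_value_step[OF C_class_DERIV(2)[of 0 f s "x + (s - t) *\<^sub>R w" i],
          of "(s - t) * c $ i"] f that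
      by (simp add: \<delta>_def)
    then obtain z where z: "\<And>s. 0 \<le> s \<Longrightarrow> \<bar>z s\<bar> \<le> \<bar>(s - t) * c $ i\<bar>"
      and \<delta>_eq: "\<And>s. 0 \<le> s \<Longrightarrow>
        \<delta> s = (s - t) * c $ i * pd i f (x + (s - t) *\<^sub>R w + z s *\<^sub>R axis i 1) s"
      by metis
    have "((\<lambda>s. \<bar>(s - t) * c $ i\<bar>) \<longlongrightarrow> \<bar>(t - t) * c $ i\<bar>) (at t within {0..})"
      by (intro tendsto_intros)
    then have "((\<lambda>s. \<bar>(s - t) * c $ i\<bar>) \<longlongrightarrow> 0) (at t within {0..})"
      by simp
    then have "(z \<longlongrightarrow> 0) (at t within {0..})"
      by (rule Lim_null_comparison[rotated]) (simp add: z eventually_at_filter)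
    then have "((\<lambda>s. (x + (s - t) *\<^sub>R w + z s *\<^sub>R axis i 1, s)) \<longlongrightarrow>
        (x + (t - t) *\<^sub>R w + 0 *\<^sub>R axis i 1, t)) (at t within {0..})"
      by (intro tendsto_intros)
    then have point: "((\<lambda>s. (x + (s - t) *\<^sub>R w + z s *\<^sub>R axis i 1, s)) \<longlongrightarrow> (x, t)) (at t within {0..})"
      by simp
    have "continuous_on (UNIV \<times> {0..}) (\<lambda>(x, t). pd i f x t)"
      using C_class_pd[of 0 f i] f by (simp add: C_class_0)
    from continuous_on_tendsto_compose[OF this point]
    have "((\<lambda>s. c $ i * pd i f (x + (s - t) *\<^sub>R w + z s *\<^sub>R axis i 1) s) \<longlongrightarrow> c $ i * pd i f x t)
        (at t within {0..})"
      using t by (intro tendsto_mult tendsto_const) (simp_all add: eventually_at_filter)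
    moreover have "\<forall>\<^sub>F s in at t within {0..}.
        c $ i * pd i f (x + (s - t) *\<^sub>R w + z s *\<^sub>R axis i 1) s = (\<delta> s - \<delta> t) / (s - t)"
    proof -
      have "\<delta> t = 0" by (simp add: \<delta>_def)
      then show ?thesis by (simp add: eventually_at_filter \<delta>_eq)
    qed
    ultimately have "(\<delta> has_real_derivative c $ i * pd i f x t) (at t within {0..})"
      unfolding has_field_derivative_iff by (rule Lim_transform_eventually)
    from DERIV_add[OF insert.IH this] show ?case
      using insert.hyps by (simp add: \<delta>_def w_def algebra_simps)
  qed
  have "(\<Sum>i\<in>UNIV. c $ i *\<^sub>R axis i 1) = c"
    using basis_expansion[of c] by (simp add: scalar_mult_eq_scaleR)
  then show ?thesis
    using partial[of UNIV "a + t *\<^sub>R c"] by (simp add: algebra_simps)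
qed

text \<open>Symmetry of second derivatives: the interchange lemma in the coordinate plane through \<open>x\<close>.\<close>

lemma pd_commute:
  fixes f :: "real ^ 'n::finite \<Rightarrow> real \<Rightarrow> real"
  assumes f: "C_class 2 f" and t: "0 \<le> t"
  shows "pd i (pd j f) x t = pd j (pd i f) x t"
proof -
  have f2: "C_class (Suc (Suc 0)) f" using f unfolding numeral_2_eq_2 .
  note f1 = C_class_pd[OF f2]
  let ?p = "\<lambda>h s. x + h *\<^sub>R axis i 1 + s *\<^sub>R axis j 1"
  have swap: "?p h s = x + s *\<^sub>R axis j 1 + h *\<^sub>R axis i 1" for h s
    by (simp only: add.assoc add.commute[of "h *\<^sub>R axis i 1"])
  have "((\<lambda>s. pd i f (x + s *\<^sub>R axis j 1) t) has_real_derivative pd i (pd j f) (?p 0 0) t)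
      (at 0 within {-1..})"
  proof (rule interchange_derivatives[where u = "\<lambda>h s. f (?p h s) t"
        and F = "\<lambda>h s. pd j f (?p h s) t" and G = "\<lambda>h s. pd i (pd j f) (?p h s) t"])
    show "((\<lambda>s. f (?p h s) t) has_real_derivative pd j f (?p h s) t) (at s within {-1..})" for h s
      by (rule has_field_derivative_at_within[OF C_class_DERIV(2)[OF f2 t]])
    show "((\<lambda>h. pd j f (?p h s) t) has_real_derivative pd i (pd j f) (?p h s) t) (at h)" for h s
      unfolding swap by (rule C_class_DERIV(2)[OF f1 t])
    show "((\<lambda>h. f (?p h s) t) has_real_derivative pd i f (x + s *\<^sub>R axis j 1) t) (at 0)" for s
      unfolding swap by (rule C_class_DERIV(1)[OF f2 t])
    show "continuous_on (UNIV \<times> {-1..}) (\<lambda>(h, s). pd i (pd j f) (?p h s) t)"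
      unfolding case_prod_unfold using t
      by (intro continuous_on_C_class[OF C_class_pd[OF f1]] continuous_intros)
  qed simp
  moreover have "at (0::real) within {-1..} = at 0"
    by (rule at_within_interior) simp
  ultimately have "((\<lambda>s. pd i f (x + s *\<^sub>R axis j 1) t) has_real_derivative pd i (pd j f) x t) (at 0)"
    by simp
  from partial_deriv_eqI(1)[where f = "\<lambda>y. pd i f y t", OF this] show ?thesis
    by (rule sym)
qed

text \<open>The interchange lemma in the plane of the \<open>i\<close>-th coordinate and time: it turns an evolution equation
  for \<open>f\<close> into one for its spatial gradient.\<close>

lemma DERIV_time_pd:
  fixes f F :: "real ^ 'n::finite \<Rightarrow> real \<Rightarrow> real"
  assumes f: "C_class 1 f" and F: "C_class 1 F"
    and time: "\<And>x t. 0 \<le> t \<Longrightarrow> (f x has_real_derivative F x t) (at t within {0..})"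
    and t: "0 \<le> t"
  shows "(pd i f x has_real_derivative pd i F x t) (at t within {0..})"
proof -
  have f': "C_class (Suc 0) f" and F': "C_class (Suc 0) F" using f F by simp_all
  have G: "continuous_on (UNIV \<times> {0..}) (\<lambda>(h, s). pd i F (x + h *\<^sub>R axis i 1) s)"
    unfolding case_prod_unfold
    by (intro continuous_on_C_class[OF C_class_pd[OF F']] continuous_intros) auto
  show ?thesis
    using interchange_derivatives[where u = "\<lambda>h s. f (x + h *\<^sub>R axis i 1) s" and b = 0 and W = "pd i f x",
        OF time C_class_DERIV(2)[OF F'] G C_class_DERIV(1)[OF f'] t]
    by simp
qed

section \<open>The Euler system along a line of vacuum\<close>

text \<open>For \<open>\<rho> \<ge> 0\<close> the pressure is \<open>e\<^sup>S \<rho>\<^sup>2 abs_power b \<rho>\<close>. Its derivative is written as the product of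
  \<open>\<rho> abs_power b \<rho>\<close> and a second factor because for \<open>\<rho>\<close> and \<open>S\<close> of class \<open>C\<^sup>2\<close> both factors are
  continuously differentiable, and on bounded sets the first one is a bounded multiple of \<open>\<rho>\<close>.\<close>

lemma pressure_partial_deriv:
  fixes S \<rho> :: "real ^ 'n::finite \<Rightarrow> real"
  assumes b: "0 \<le> b" and \<rho>: "\<And>x. 0 \<le> \<rho> x"
    and "has_partial_deriv j S x" "has_partial_deriv j \<rho> x"
  shows "partial_deriv j (pressure (b + 2) S \<rho>) x = \<rho> x * abs_power b (\<rho> x) *
    (exp (S x) * (partial_deriv j S x * \<rho> x + (b + 2) * partial_deriv j \<rho> x))"
proof (rule partial_deriv_eqI(1))
  have "r powr (b + 2) = r * (r * abs_power b r)" if "0 \<le> r" for r :: real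
    using that by (auto simp: abs_power_def powr_add power2_eq_square)
  then have *: "pressure (b + 2) S \<rho> y = exp (S y) * (\<rho> y * (\<rho> y * abs_power b (\<rho> y)))" for y
    by (simp add: pressure_def \<rho>)
  note S' = partial_deriv_DERIV[OF assms(3)] and \<rho>' = partial_deriv_DERIV[OF assms(4)]
  have "((\<lambda>h. \<rho> (x + h *\<^sub>R axis j 1) * abs_power b (\<rho> (x + h *\<^sub>R axis j 1))) has_real_derivative
      (b + 1) * abs_power b (\<rho> x) * partial_deriv j \<rho> x) (at 0)"
    using DERIV_chain2[OF DERIV_mult_abs_power[OF b] \<rho>'] by simp
  note vacuum_factor' = this
  show "((\<lambda>h. pressure (b + 2) S \<rho> (x + h *\<^sub>R axis j 1)) has_real_derivative
      \<rho> x * abs_power b (\<rho> x) *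
      (exp (S x) * (partial_deriv j S x * \<rho> x + (b + 2) * partial_deriv j \<rho> x))) (at 0)"
    using DERIV_mult[OF DERIV_chain2[OF DERIV_exp S'] DERIV_mult[OF \<rho>' vacuum_factor']]
    unfolding * by (simp add: algebra_simps)
qed

text \<open>A zero of a nonnegative function is a minimum.\<close>

lemma partial_deriv_at_zero_of_nonneg:
  assumes "has_partial_deriv i f x" and "\<And>y. 0 \<le> f y" and "f x = 0"
  shows "partial_deriv i f x = 0"
  by (rule DERIV_local_min[OF partial_deriv_DERIV[OF assms(1)] zero_less_one])
    (simp add: assms)

locale C2_euler_flow =
  fixes \<gamma> :: real
    and v0 :: "real ^ 'n::finite \<Rightarrow> real ^ 'n" and \<rho>0 S0 :: "real ^ 'n \<Rightarrow> real"
    and v :: "real ^ 'n \<Rightarrow> real \<Rightarrow> real ^ 'n" and \<rho> S :: "real ^ 'n \<Rightarrow> real \<Rightarrow> real"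
  assumes \<gamma>: "\<gamma> \<ge> 2"
    and solution: "euler_solution \<gamma> v0 \<rho>0 S0 v \<rho> S"
    and v_C2: "C_class 2 (\<lambda>x t. v x t $ j)"
    and \<rho>_C2: "C_class 2 \<rho>"
    and S_C2: "C_class 2 S"
begin

abbreviation dv :: "'n \<Rightarrow> 'n \<Rightarrow> real ^ 'n \<Rightarrow> real \<Rightarrow> real" where
  "dv i j \<equiv> pd i (\<lambda>x t. v x t $ j)"

text \<open>The two factors of the pressure gradient in \<open>pressure_partial_deriv\<close>.\<close>

definition vacuum_factor :: "real ^ 'n \<Rightarrow> real \<Rightarrow> real" where
  "vacuum_factor x t = \<rho> x t * abs_power (\<gamma> - 2) (\<rho> x t)"

definition cofactor :: "'n \<Rightarrow> real ^ 'n \<Rightarrow> real \<Rightarrow> real" where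
  "cofactor j x t = exp (S x t) * (pd j S x t * \<rho> x t + \<gamma> * pd j \<rho> x t)"

text \<open>The time derivative of \<open>v\<close> at a fixed point of space, expressed by spatial derivatives.\<close>

definition acceleration :: "'n \<Rightarrow> real ^ 'n \<Rightarrow> real \<Rightarrow> real" where
  "acceleration j x t = - (\<Sum>k\<in>UNIV. v x t $ k * dv k j x t) - vacuum_factor x t * cofactor j x t"

lemma Suc_C2: "C_class (Suc (Suc 0)) (\<lambda>x t. v x t $ j)" "C_class (Suc (Suc 0)) \<rho>"
  "C_class (Suc (Suc 0)) S"
  using v_C2 \<rho>_C2 S_C2 unfolding numeral_2_eq_2 .

lemma C1: "C_class (Suc 0) (\<lambda>x t. v x t $ j)" "C_class (Suc 0) \<rho>" "C_class (Suc 0) S"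
  by (rule C_class_mono[OF Suc_C2(1)] C_class_mono[OF Suc_C2(2)] C_class_mono[OF Suc_C2(3)], simp)+

lemma \<rho>_nonneg: "0 \<le> t \<Longrightarrow> 0 \<le> \<rho> x t"
  using solution by (auto simp: euler_solution_def)

lemma initial: "v x 0 = v0 x" "\<rho> x 0 = \<rho>0 x"
  using solution by (auto simp: euler_solution_def)

lemma \<rho>_time:
  assumes "0 \<le> t"
  shows "(\<rho> x has_real_derivative
    - (\<Sum>i\<in>UNIV. v x t $ i * pd i \<rho> x t) - \<rho> x t * (\<Sum>i\<in>UNIV. dv i i x t)) (at t within {0..})"
proof -
  obtain d where "(\<rho> x has_real_derivative d) (at t within {0..})"
    and "d + advect (\<lambda>y. v y t) (\<lambda>y. \<rho> y t) x = - \<rho> x t * divergence (\<lambda>y. v y t) x"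
    using solution[unfolded euler_solution_def, THEN conjunct2, THEN conjunct1, rule_format, OF assms, of x]
    by blast
  moreover from this(2) have
    "d = - (\<Sum>i\<in>UNIV. v x t $ i * pd i \<rho> x t) - \<rho> x t * (\<Sum>i\<in>UNIV. dv i i x t)"
    by (simp add: advect_def divergence_def algebra_simps)
  ultimately show ?thesis by simp
qed

lemma v_time:
  assumes "0 \<le> t"
  shows "((\<lambda>s. v x s $ j) has_real_derivative acceleration j x t) (at t within {0..})"
proof -
  obtain d where d: "(v x has_vector_derivative d) (at t within {0..})"
    and eq: "d + (\<chi> j. advect (\<lambda>y. v y t) (\<lambda>y. v y t $ j) x) =
        - gradient (pressure \<gamma> (\<lambda>y. S y t) (\<lambda>y. \<rho> y t)) x"
    using solution[unfolded euler_solution_def, THEN conjunct2, THEN conjunct2, THEN conjunct1,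
        rule_format, OF assms, of x]
    by blast
  have "((\<lambda>s. v x s $ j) has_real_derivative d $ j) (at t within {0..})"
    using bounded_linear.has_vector_derivative[OF bounded_linear_vec_nth d]
    by (simp add: has_real_derivative_iff_has_vector_derivative)
  moreover have "partial_deriv j (pressure \<gamma> (\<lambda>y. S y t) (\<lambda>y. \<rho> y t)) x = vacuum_factor x t * cofactor j x t"
    using pressure_partial_deriv[of "\<gamma> - 2" "\<lambda>y. \<rho> y t" j "\<lambda>y. S y t" x] \<gamma> assms \<rho>_nonneg C1(2,3)
    by (simp add: vacuum_factor_def cofactor_def C_class_Suc)
  moreover have "d $ j + advect (\<lambda>y. v y t) (\<lambda>y. v y t $ j) x =
      - partial_deriv j (pressure \<gamma> (\<lambda>y. S y t) (\<lambda>y. \<rho> y t)) x"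
    using arg_cong[OF eq, of "\<lambda>z. z $ j"] by (simp add: gradient_def)
  ultimately have "d $ j = acceleration j x t"
    unfolding acceleration_def advect_def by linarith
  with \<open>((\<lambda>s. v x s $ j) has_real_derivative d $ j) (at t within {0..})\<close> show ?thesis
    by simp
qed

lemma abs_power_\<rho>_C0: "C_class 0 (\<lambda>x t. abs_power (\<gamma> - 2) (\<rho> x t))"
  using \<gamma> C_class_mono[OF \<rho>_C2, of 0]
  by (auto simp: C_class_0 case_prod_unfold intro!: continuous_on_abs_power)

text \<open>The derivative of the first factor is proportional to that of \<open>\<rho>\<close>, so both the factor
  and its gradient vanish at vacuum points.\<close>

lemma
  shows vacuum_factor_C1: "C_class (Suc 0) vacuum_factor"
    and pd_vacuum_factor: "0 \<le> t \<Longrightarrow>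
      pd i vacuum_factor x t = (\<gamma> - 1) * abs_power (\<gamma> - 2) (\<rho> x t) * pd i \<rho> x t"
proof -
  have *: "((\<lambda>r. r * abs_power (\<gamma> - 2) r) has_real_derivative (\<gamma> - 1) * abs_power (\<gamma> - 2) r) (at r)" for r
    using DERIV_mult_abs_power[of "\<gamma> - 2" r] \<gamma> by (simp add: algebra_simps)
  note compose = C_class_compose[OF C1(2) *, OF C_class_mult[OF C_class_const abs_power_\<rho>_C0]]
  show "C_class (Suc 0) vacuum_factor"
    using compose(1) by (simp add: vacuum_factor_def[abs_def])
  show "0 \<le> t \<Longrightarrow> pd i vacuum_factor x t = (\<gamma> - 1) * abs_power (\<gamma> - 2) (\<rho> x t) * pd i \<rho> x t"
    using compose(2) by (simp add: vacuum_factor_def[abs_def])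
qed

lemma cofactor_C1: "C_class (Suc 0) (cofactor j)"
proof -
  have "C_class 0 (\<lambda>x t. exp (S x t))"
    using C_class_mono[OF S_C2, of 0]
    by (auto simp: C_class_0 case_prod_unfold intro!: continuous_intros)
  then have "C_class (Suc 0) (\<lambda>x t. exp (S x t))"
    by (intro C_class_compose(1)[OF C1(3)]) (rule DERIV_exp)
  then show ?thesis
    unfolding cofactor_def[abs_def]
    by (intro C_class_mult C_class_add C_class_const C_class_pd Suc_C2 C1)
qed

lemma acceleration_C1: "C_class (Suc 0) (acceleration j)"
proof -
  have "C_class (Suc 0) (\<lambda>x t. - (\<Sum>k\<in>UNIV. v x t $ k * dv k j x t) + - (vacuum_factor x t * cofactor j x t))"
    by (intro C_class_add C_class_minus C_class_sum C_class_mult C_class_pd Suc_C2 C1 vacuum_factor_C1 cofactor_C1)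
  then show ?thesis
    by (simp add: acceleration_def[abs_def])
qed

text \<open>Set \<open>y = (v - v0(a), \<rho>)\<close> on the line. The direction of the line is \<open>v0(a)\<close>, so the convective terms
  combine with the derivative along the line to \<open>- ((v - v0(a)) \<cdot> \<nabla>) v\<close> and
  \<open>- ((v - v0(a)) \<cdot> \<nabla>) \<rho>\<close>, which are linear in \<open>y\<close> with continuous coefficients. The terms
  \<open>\<rho> div v\<close> and \<open>\<nabla>p\<close> contain the factor \<open>\<rho>\<close>. Thus \<open>y\<close> solves a homogeneous linear system with zero
  initial values.\<close>

lemma vacuum_along_line:
  assumes "\<rho>0 a = 0" and t: "0 \<le> t"
  shows "v (a + t *\<^sub>R v0 a) t = v0 a" and "\<rho> (a + t *\<^sub>R v0 a) t = 0"
proof -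
  let ?X = "\<lambda>t. a + t *\<^sub>R v0 a"
  \<comment> \<open>The index \<open>None\<close> stands for the density, \<open>Some j\<close> for the \<open>j\<close>-th velocity component.\<close>
  define y where "y k t = (case k of None \<Rightarrow> \<rho> (?X t) t | Some j \<Rightarrow> v (?X t) t $ j - v0 a $ j)" for k t
  define A where "A k l t = (case k of
      None \<Rightarrow> (case l of None \<Rightarrow> - (\<Sum>i\<in>UNIV. dv i i (?X t) t) | Some i \<Rightarrow> - pd i \<rho> (?X t) t)
    | Some j \<Rightarrow> (case l of None \<Rightarrow> - (abs_power (\<gamma> - 2) (\<rho> (?X t) t) * cofactor j (?X t) t)
                        | Some i \<Rightarrow> - dv i j (?X t) t))" for k l t
  have sum_option: "(\<Sum>k\<in>UNIV. g k) = g None + (\<Sum>i\<in>UNIV. g (Some i))" for g :: "'n option \<Rightarrow> real"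
    by (simp add: UNIV_option_conv sum.reindex)
  have "y k t = 0" for k
  proof (rule linear_ode_zero[where y = y and A = A, OF _ _ _ t])
    show "(y k has_real_derivative (\<Sum>l\<in>UNIV. A k l t * y l t)) (at t within {0..})"
      if "0 \<le> t" for k t
    proof (cases k)
      case None
      have "(y k has_real_derivative - (\<Sum>i\<in>UNIV. v (?X t) t $ i * pd i \<rho> (?X t) t)
          - \<rho> (?X t) t * (\<Sum>i\<in>UNIV. dv i i (?X t) t)
          + (\<Sum>i\<in>UNIV. v0 a $ i * pd i \<rho> (?X t) t)) (at t within {0..})"
        using DERIV_along_line[where a = a and c = "v0 a", OF _ \<rho>_time that] C1(2)
        by (simp add: y_def[abs_def] None)
      then show ?thesis
        by (simp add: None sum_option A_def y_def algebra_simps sum_subtractf sum_negf)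
    next
      case (Some j)
      have "((\<lambda>s. v (?X s) s $ j) has_real_derivative acceleration j (?X t) t
          + (\<Sum>i\<in>UNIV. v0 a $ i * dv i j (?X t) t)) (at t within {0..})"
        using DERIV_along_line[where f = "\<lambda>x t. v x t $ j" and a = a and c = "v0 a",
            OF _ v_time that] C1(1)
        by simp
      then have "(y k has_real_derivative acceleration j (?X t) t
          + (\<Sum>i\<in>UNIV. v0 a $ i * dv i j (?X t) t)) (at t within {0..})"
        by (auto simp: y_def[abs_def] Some intro!: derivative_eq_intros)
      then show ?thesis
        by (simp add: Some sum_option A_def y_def acceleration_def vacuum_factor_def algebra_simps
            sum_subtractf sum_negf)
    qed
    show "continuous_on {0..} (A k l)" for k l
      unfolding A_def[abs_def]
      by (cases k; cases l)
        (auto intro!: continuous_intros continuous_on_C_class[OF C1(1)] continuous_on_C_class[OF C1(2)]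
          continuous_on_C_class[OF C_class_pd[OF C1(1)]] continuous_on_C_class[OF C_class_pd[OF C1(2)]]
          continuous_on_C_class[OF abs_power_\<rho>_C0] continuous_on_C_class[OF cofactor_C1])
    show "y k 0 = 0" for k
      using assms(1) by (cases k) (simp_all add: y_def initial)
  qed
  note zero = this
  show "\<rho> (?X t) t = 0"
    using zero[of None] by (simp add: y_def)
  show "v (?X t) t = v0 a"
    using zero[of "Some j" for j] by (simp add: y_def vec_eq_iff)
qed

section \<open>Blow-up of the velocity gradient\<close>

text \<open>In the spatial derivative of the momentum equation the pressure contributes nothing, as its first
  factor vanishes on the line together with its gradient. The second derivatives of \<open>v\<close> are
  transported with velocity \<open>v0(a)\<close>, which by \<open>pd_commute\<close> is the contribution of the moving
  point to the derivative along the line, so the two cancel.\<close>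

lemma gradient_riccati:
  assumes "\<rho>0 a = 0" and t: "0 \<le> t"
  defines "X \<equiv> \<lambda>t. a + t *\<^sub>R v0 a"
  shows "((\<lambda>t. dv i j (X t) t) has_real_derivative
    - (\<Sum>k\<in>UNIV. dv i k (X t) t * dv k j (X t) t)) (at t within {0..})"
proof -
  have v_X: "v (X t) t = v0 a" and \<rho>_X: "\<rho> (X t) t = 0"
    using vacuum_along_line[OF assms(1,2)] by (simp_all add: X_def)
  have q_X: "vacuum_factor (X t) t = 0" by (simp add: vacuum_factor_def \<rho>_X)
  have "pd i \<rho> (X t) t = 0"
    using C1(2) t \<rho>_nonneg \<rho>_X by (intro partial_deriv_at_zero_of_nonneg) (auto simp: C_class_Suc)
  then have dq_X: "pd i vacuum_factor (X t) t = 0"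
    by (simp add: pd_vacuum_factor t)
  have "((\<lambda>h. acceleration j (X t + h *\<^sub>R axis i 1) t) has_real_derivative
      - (\<Sum>k\<in>UNIV. dv i k (X t) t * dv k j (X t) t + v0 a $ k * pd i (dv k j) (X t) t)) (at 0)"
    unfolding acceleration_def
    by (rule derivative_eq_intros DERIV_sum C_class_DERIV(1)[OF C1(1) t]
        C_class_DERIV(1)[OF C_class_pd[OF Suc_C2(1)] t]
        C_class_DERIV(1)[OF vacuum_factor_C1 t] C_class_DERIV(1)[OF cofactor_C1 t] refl)+
      (simp add: v_X q_X dq_X algebra_simps)
  then have "pd i (acceleration j) (X t) t =
      - (\<Sum>k\<in>UNIV. dv i k (X t) t * dv k j (X t) t + v0 a $ k * pd i (dv k j) (X t) t)"
    by (rule partial_deriv_eqI(1))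
  moreover have "pd i (dv k j) (X t) t = pd k (dv i j) (X t) t" for k
    by (rule pd_commute[OF v_C2 t])
  moreover have "((\<lambda>t. dv i j (X t) t) has_real_derivative pd i (acceleration j) (X t) t +
      (\<Sum>k\<in>UNIV. v0 a $ k * pd k (dv i j) (X t) t)) (at t within {0..})"
    unfolding X_def
  proof (rule DERIV_along_line[OF _ DERIV_time_pd t])
    show "C_class 1 (dv i j)" using C_class_pd[OF Suc_C2(1)] by simp
    show "C_class 1 (\<lambda>x t. v x t $ j)" "C_class 1 (acceleration j)"
      using C1(1) acceleration_C1 by simp_all
  qed (rule v_time)
  ultimately show ?thesis
    by (simp add: sum.distrib)
qed

text \<open>The solution of the Riccati equation is formally \<open>V(t) = V(0) (I + t V(0))\<^sup>-\<^sup>1\<close>, which on the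
  eigenvector \<open>w\<close> reads \<open>(1 + t l) V(t) w = l w\<close>. The difference of the two sides solves a linear
  system and starts from zero, so the identity holds without inverting any matrix; at
  \<open>t = - 1 / l\<close> it is absurd.\<close>

lemma eigenvalue_nonneg:
  assumes "\<rho>0 a = 0" and "vorticity v0 a = 0" and "is_eigenvalue (deformation v0 a) l"
  shows "0 \<le> l"
proof (rule ccontr)
  assume "\<not> 0 \<le> l"
  then have l: "l < 0" by simp
  obtain w where "w \<noteq> 0" and w: "deformation v0 a *v w = l *s w"
    using assms(3) by (auto simp: is_eigenvalue_def)
  define V where "V i j t = dv i j (a + t *\<^sub>R v0 a) t" for i j t
  have V_deriv: "(V i j has_real_derivative - (\<Sum>k\<in>UNIV. V i k t * V k j t)) (at t within {0..})"
    if "0 \<le> t" for i j t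
    using gradient_riccati[OF assms(1) that] by (simp add: V_def[abs_def])
  have "deformation v0 a $ i $ j = V i j 0" for i j
  proof -
    have "vorticity v0 a $ i $ j = 0" using assms(2) by simp
    then show ?thesis by (simp add: vorticity_def deformation_def V_def initial)
  qed
  then have V0: "(\<Sum>j\<in>UNIV. V i j 0 * w $ j) = l * w $ i" for i
    using arg_cong[OF w, of "\<lambda>z. z $ i"] by (simp add: matrix_vector_mult_def)
  define z where "z i t = (1 + t * l) * (\<Sum>j\<in>UNIV. V i j t * w $ j) - l * w $ i" for i t
  have "z i (- 1 / l) = 0" for i
  proof (rule linear_ode_zero[where y = z and A = "\<lambda>i k t. - V i k t"])
    show "(z i has_real_derivative (\<Sum>k\<in>UNIV. - V i k t * z k t)) (at t within {0..})"
      if "0 \<le> t" for i t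
    proof -
      have "(z i has_real_derivative l * (\<Sum>j\<in>UNIV. V i j t * w $ j)
          + (1 + t * l) * (\<Sum>j\<in>UNIV. - (\<Sum>k\<in>UNIV. V i k t * V k j t) * w $ j)) (at t within {0..})"
        unfolding z_def[abs_def]
        by (rule derivative_eq_intros DERIV_sum V_deriv that refl)+ (simp add: algebra_simps)
      also have "(\<Sum>j\<in>UNIV. - (\<Sum>k\<in>UNIV. V i k t * V k j t) * w $ j)
          = - (\<Sum>k\<in>UNIV. V i k t * (\<Sum>j\<in>UNIV. V k j t * w $ j))"
        unfolding sum_distrib_right sum_distrib_left sum_negf[symmetric]
        by (subst sum.swap) (simp add: mult.assoc)
      also have "l * (\<Sum>j\<in>UNIV. V i j t * w $ j)
          + (1 + t * l) * - (\<Sum>k\<in>UNIV. V i k t * (\<Sum>j\<in>UNIV. V k j t * w $ j))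
          = (\<Sum>k\<in>UNIV. - V i k t * z k t)"
        unfolding z_def
        by (simp add: sum_subtractf sum_negf sum_distrib_left algebra_simps sum.distrib)
      finally show ?thesis .
    qed
    show "continuous_on {0..} (\<lambda>t. - V i k t)" for i k
      using V_deriv by (intro continuous_intros DERIV_continuous_on) auto
    show "z i 0 = 0" for i
      by (simp add: z_def V0)
    show "0 \<le> - 1 / l"
      using l by (simp add: divide_nonpos_neg)
  qed
  then have "w $ i = 0" for i
    using l by (simp add: z_def)
  with \<open>w \<noteq> 0\<close> show False
    by (simp add: vec_eq_iff)
qed

end

theorem theorem3p1:
  fixes \<gamma> :: real
    and v0 :: "real ^ 'n::finite \<Rightarrow> real ^ 'n"
    and \<rho>0 S0 :: "real ^ 'n \<Rightarrow> real"
  assumes "\<gamma> \<ge> 2"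
    and "S3_set v0 \<rho>0 S0 \<noteq> {}"
  shows "\<not> (\<exists>v \<rho> S. euler_solution \<gamma> v0 \<rho>0 S0 v \<rho> S \<and>
            (\<forall>j. C_class 3 (\<lambda>x t. v x t $ j)) \<and> C_class 3 \<rho> \<and> C_class 3 S)"
proof
  assume "\<exists>v \<rho> S. euler_solution \<gamma> v0 \<rho>0 S0 v \<rho> S \<and>
            (\<forall>j. C_class 3 (\<lambda>x t. v x t $ j)) \<and> C_class 3 \<rho> \<and> C_class 3 S"
  then obtain v \<rho> S where "euler_solution \<gamma> v0 \<rho>0 S0 v \<rho> S"
    and "\<And>j. C_class 3 (\<lambda>x t. v x t $ j)" and "C_class 3 \<rho>" and "C_class 3 S"
    by blast
  then interpret C2_euler_flow \<gamma> v0 \<rho>0 S0 v \<rho> S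
    using assms(1) by unfold_locales (auto intro: C_class_mono[of 3 _ 2])
  obtain a l where "vorticity v0 a = 0" and "all_partials_vanish 0 \<rho>0 a"
    and "is_eigenvalue (deformation v0 a) l" and "l < 0"
    using assms(2) by (auto simp: S3_set_def)
  moreover from this(2) have "\<rho>0 a = 0"
    by (auto simp: all_partials_vanish_def iter_partial_def)
  ultimately show False
    using eigenvalue_nonneg by fastforce
qed

end
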